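(* Let $G$ be a finite non-cyclic group. The graph $\overline{\mathcal{P}_E(G^* )}$ is dominatable if and only if $G$ has a maximal cyclic subgroup of order $2$.
   Context: The enhanced power graph $\mathcal{P}_E(G)$ of a group $G$ is the simple undirected graph with vertex set $G$ in which two distinct vertices $x,y$ are adjacent if $x,y\in\langle z\rangle$ for some $z\in G$. Its complement $\overline{\mathcal{P}_E(G)}$ has the same vertex set $G$, and distinct $x,y$ are adjacent in it if and only if they are not adjacent in $\mathcal{P}_E(G)$. The graph $\overline{\mathcal{P}_E(G^* )}$ is the subgraph of $\overline{\mathcal{P}_E(G)}$ induced by all the non-isolated vertices of $\overline{\mathcal{P}_E(G)}$. A graph is dominatable if it has a dominating vertex, i.e. a vertex adjacent to all other vertices of the graph. A maximal cyclic subgroup of $G$ is a cyclic subgroup of $G$ not properly contained in any other cyclic subgroup of $G$. *)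

theory Defs
  imports
    "HOL-Algebra.Elementary_Groups"
    "Graph_Theory.Digraph_Component"
begin

text \<open>
  A simple undirected graph is a symmetric loop-free digraph without parallel arcs, i.e. an
  edge between x and y is the pair of arcs (x, y) and (y, x); for finite graphs this is the
  locale \<^locale>\<open>pair_graph\<close>.
\<close>

definition enhanced_power_graph :: "('a, 'b) monoid_scheme \<Rightarrow> 'a pair_pre_digraph" where
  "enhanced_power_graph G =
    \<lparr> pverts = carrier G,
      parcs = {(x, y). x \<in> carrier G \<and> y \<in> carrier G \<and> x \<noteq> y \<and>
                 (\<exists>z \<in> carrier G. x \<in> generate G {z} \<and> y \<in> generate G {z})} \<rparr>"

definition complement_graph :: "'a pair_pre_digraph \<Rightarrow> 'a pair_pre_digraph" where
  "complement_graph H =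
    \<lparr> pverts = pverts H,
      parcs = {(x, y). x \<in> pverts H \<and> y \<in> pverts H \<and> x \<noteq> y \<and> (x, y) \<notin> parcs H} \<rparr>"

text \<open>The next two notions are meant for symmetric digraphs, so they look at outgoing arcs only.\<close>

definition isolated_vertex :: "('a, 'b) pre_digraph \<Rightarrow> 'a \<Rightarrow> bool" where
  "isolated_vertex H v \<longleftrightarrow> v \<in> verts H \<and> (\<forall>u \<in> verts H. \<not> v \<rightarrow>\<^bsub>H\<^esub> u)"

definition dominating_vertex :: "('a, 'b) pre_digraph \<Rightarrow> 'a \<Rightarrow> bool" where
  "dominating_vertex H v \<longleftrightarrow> v \<in> verts H \<and> (\<forall>u \<in> verts H. u \<noteq> v \<longrightarrow> v \<rightarrow>\<^bsub>H\<^esub> u)"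

definition dominatable :: "('a, 'b) pre_digraph \<Rightarrow> bool" where
  "dominatable H \<longleftrightarrow> (\<exists>v. dominating_vertex H v)"

definition remove_isolated :: "('a, 'b) pre_digraph \<Rightarrow> ('a, 'b) pre_digraph" where
  "remove_isolated H = H \<restriction> {v \<in> verts H. \<not> isolated_vertex H v}"

definition proper_complement_enhanced_power_graph ::
    "('a, 'b) monoid_scheme \<Rightarrow> ('a, 'a \<times> 'a) pre_digraph" where
  "proper_complement_enhanced_power_graph G =
    remove_isolated (with_proj (complement_graph (enhanced_power_graph G)))"

definition cyclic_subgroup :: "'a set \<Rightarrow> ('a, 'b) monoid_scheme \<Rightarrow> bool" where
  "cyclic_subgroup H G \<longleftrightarrow> subgroup H G \<and> cyclic_group (G\<lparr>carrier := H\<rparr>)"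

definition maximal_cyclic_subgroup :: "'a set \<Rightarrow> ('a, 'b) monoid_scheme \<Rightarrow> bool" where
  "maximal_cyclic_subgroup H G \<longleftrightarrow>
    cyclic_subgroup H G \<and> \<not> (\<exists>K. cyclic_subgroup K G \<and> H \<subset> K)"

lemma pair_graph_enhanced_power_graph:
  assumes "finite (carrier G)"
  shows "pair_graph (enhanced_power_graph G)"
proof -
  have "finite (parcs (enhanced_power_graph G))"
    by (rule finite_subset[of _ "carrier G \<times> carrier G"])
       (use assms in \<open>auto simp: enhanced_power_graph_def\<close>)
  then show ?thesis
    using assms
    by unfold_locales (auto simp: enhanced_power_graph_def symmetric_def sym_def)
qed

lemma pair_graph_complement_graph:
  assumes "pair_graph H"
  shows "pair_graph (complement_graph H)"
proof -
  interpret pair_graph H by fact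
  have "finite (parcs (complement_graph H))"
    by (rule finite_subset[of _ "pverts H \<times> pverts H"])
       (auto simp: complement_graph_def)
  moreover have "(y, x) \<in> parcs H \<longleftrightarrow> (x, y) \<in> parcs H" for x y
    using pair_sym_arcs by (auto simp: symmetric_def sym_def)
  ultimately show ?thesis
    by unfold_locales (auto simp: complement_graph_def symmetric_def sym_def)
qed

end

theory Submission
  imports Defs
begin

text \<open>
  Call two elements cocyclic if some cyclic subgroup contains both; the vertices of the graph in
  question are the elements that fail to be cocyclic with some element, and its edges are the
  non-cocyclic pairs. The proof rests on one observation: the elements cocyclic with \<open>z\<close> are among
  those cocyclic with any member of \<open>\<langle>z\<rangle>\<close>, because a cyclic subgroup containing \<open>z\<close> contains all
  of \<open>\<langle>z\<rangle>\<close>. Hence if \<open>v \<in> \<langle>z\<rangle>\<close> is a vertex then so is \<open>z\<close>.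

  Let \<open>v\<close> dominate. Every \<open>z\<close> with \<open>v \<in> \<langle>z\<rangle>\<close> is a vertex that is cocyclic with \<open>v\<close>, so
  \<open>z = v\<close>. Two choices of \<open>z\<close> suffice: the generator of a cyclic subgroup containing \<open>\<langle>v\<rangle>\<close>
  shows that \<open>\<langle>v\<rangle>\<close> is maximal cyclic, and the inverse of \<open>v\<close> shows that \<open>v\<close> is an involution,
  being distinct from the isolated element \<open>\<one>\<close>.
  Conversely, a generator \<open>h\<close> of a maximal cyclic subgroup of order two is cocyclic with \<open>\<one>\<close> and
  \<open>h\<close> only. As \<open>\<one>\<close> is isolated, \<open>h\<close> is adjacent to every other vertex, and it is itself a vertex
  as soon as the group has a third element, which non-cyclicity provides.
\<close>

definition cocyclic :: "('a, 'b) monoid_scheme \<Rightarrow> 'a \<Rightarrow> 'a \<Rightarrow> bool" where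
  "cocyclic G x y \<longleftrightarrow> (\<exists>z \<in> carrier G. x \<in> generate G {z} \<and> y \<in> generate G {z})"

lemma cocyclic_refl: "x \<in> carrier G \<Longrightarrow> cocyclic G x x"
  unfolding cocyclic_def by (blast intro: generate.incl)

lemma cocyclic_one: "x \<in> carrier G \<Longrightarrow> cocyclic G \<one>\<^bsub>G\<^esub> x"
  unfolding cocyclic_def by (blast intro: generate.incl generate.one)

text \<open>
  Arcs of the complement join distinct vertices only, but since every element is cocyclic with
  itself, \<open>\<not> cocyclic G v w\<close> already forces \<open>v \<noteq> w\<close>. The two existential conditions say that
  \<open>v\<close> and \<open>u\<close> survive the removal of isolated vertices.
\<close>

lemma dominating_vertex_iff_cocyclic:
  "dominating_vertex (proper_complement_enhanced_power_graph G) v \<longleftrightarrow>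
    v \<in> carrier G \<and> (\<exists>w \<in> carrier G. \<not> cocyclic G v w) \<and>
    (\<forall>u \<in> carrier G. u \<noteq> v \<and> (\<exists>w \<in> carrier G. \<not> cocyclic G u w) \<longrightarrow> \<not> cocyclic G v u)"
proof -
  let ?C = "with_proj (complement_graph (enhanced_power_graph G))"
  have arc: "x \<rightarrow>\<^bsub>?C\<^esub> y \<longleftrightarrow> x \<in> carrier G \<and> y \<in> carrier G \<and> \<not> cocyclic G x y" for x y
    using cocyclic_refl[of x G]
    by (auto simp: complement_graph_def enhanced_power_graph_def cocyclic_def arcs_ends_conv)
  have verts: "verts ?C = carrier G"
    by (simp add: complement_graph_def enhanced_power_graph_def)
  have iso: "isolated_vertex ?C x \<longleftrightarrow> x \<in> carrier G \<and> (\<forall>w \<in> carrier G. cocyclic G x w)" for x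
    unfolding isolated_vertex_def arc verts by auto
  have vertsP: "verts (proper_complement_enhanced_power_graph G) =
      {x \<in> carrier G. \<exists>w \<in> carrier G. \<not> cocyclic G x w}"
    unfolding proper_complement_enhanced_power_graph_def remove_isolated_def induce_subgraph_verts
      iso verts by auto
  have restrict: "x \<rightarrow>\<^bsub>H \<restriction> S\<^esub> y \<longleftrightarrow> x \<in> S \<and> y \<in> S \<and> x \<rightarrow>\<^bsub>H\<^esub> y"
    for H :: "('a, 'a \<times> 'a) pre_digraph" and S x y
    by (auto simp: arcs_ends_conv)
  have arcP: "x \<rightarrow>\<^bsub>proper_complement_enhanced_power_graph G\<^esub> y \<longleftrightarrow>
      x \<in> verts (proper_complement_enhanced_power_graph G) \<and>
      y \<in> verts (proper_complement_enhanced_power_graph G) \<and> \<not> cocyclic G x y" for x y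
    unfolding vertsP
    unfolding proper_complement_enhanced_power_graph_def remove_isolated_def restrict iso arc verts
    by auto
  show ?thesis
    by (auto simp: dominating_vertex_def arcP vertsP)
qed

context group
begin

lemma generate_singleton_subset_iff:
  assumes "x \<in> carrier G" and "z \<in> carrier G"
  shows "generate G {x} \<subseteq> generate G {z} \<longleftrightarrow> x \<in> generate G {z}"
  using assms generate_subgroup_incl[of "{x}" "generate G {z}"] generate_is_subgroup[of "{z}"]
  by (auto intro: generate.incl)

lemma cyclic_subgroup_iff_generate:
  "cyclic_subgroup H G \<longleftrightarrow> (\<exists>x \<in> carrier G. H = generate G {x})"
proof
  assume H: "cyclic_subgroup H G"
  then have sub: "subgroup H G"
    by (simp add: cyclic_subgroup_def)
  from H obtain x where x: "x \<in> H"
      and eq: "subgroup_generated (G\<lparr>carrier := H\<rparr>) {x} = G\<lparr>carrier := H\<rparr>"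
    by (auto simp: cyclic_subgroup_def cyclic_group_def)
  from eq have "carrier (subgroup_generated (G\<lparr>carrier := H\<rparr>) {x}) = H"
    by simp
  then have "generate (G\<lparr>carrier := H\<rparr>) {x} = H"
    using x by (simp add: carrier_subgroup_generated)
  then have "H = generate G {x}"
    using generate_consistent[of "{x}" H] x sub by simp
  then show "\<exists>x \<in> carrier G. H = generate G {x}"
    using subgroup.mem_carrier[OF sub x] by blast
next
  assume "\<exists>x \<in> carrier G. H = generate G {x}"
  then obtain x where x: "x \<in> carrier G" "H = generate G {x}"
    by blast
  have "subgroup_generated G {x} = G\<lparr>carrier := H\<rparr>"
    using x by (simp add: subgroup_generated_def)
  with cyclic_group_generated[of x] show "cyclic_subgroup H G"
    using x generate_is_subgroup[of "{x}"] by (simp add: cyclic_subgroup_def)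
qed

lemma maximal_cyclic_generate_iff:
  assumes "x \<in> carrier G"
  shows "maximal_cyclic_subgroup (generate G {x}) G \<longleftrightarrow>
    (\<forall>z \<in> carrier G. x \<in> generate G {z} \<longrightarrow> generate G {z} = generate G {x})"
proof -
  have "maximal_cyclic_subgroup (generate G {x}) G \<longleftrightarrow>
      (\<forall>z \<in> carrier G. generate G {x} \<subseteq> generate G {z} \<longrightarrow> generate G {z} = generate G {x})"
    unfolding maximal_cyclic_subgroup_def cyclic_subgroup_iff_generate psubset_eq
    using assms by blast
  then show ?thesis
    using assms by (simp add: generate_singleton_subset_iff)
qed

text \<open>
  A cyclic subgroup containing \<open>z\<close> contains the whole of \<open>\<langle>z\<rangle>\<close>, in particular \<open>v\<close>. Read
  contrapositively, this makes \<open>z\<close> a vertex whenever \<open>v\<close> is one.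
\<close>

lemma cocyclic_generator_imp_cocyclic:
  assumes "z \<in> carrier G" and "v \<in> generate G {z}" and "cocyclic G z w"
  shows "cocyclic G v w"
  using assms generate_singleton_subset_iff unfolding cocyclic_def by blast

text \<open>
  The element \<open>z\<close> is a vertex because \<open>v\<close> is, but \<open>\<langle>z\<rangle>\<close> contains both; so \<open>z\<close> cannot be another
  vertex adjacent to \<open>v\<close>. Equality of the elements, and not just of \<open>\<langle>z\<rangle>\<close> and \<open>\<langle>v\<rangle>\<close>, is what
  bounds the order of \<open>v\<close>.
\<close>

lemma dominating_vertex_only_generator:
  assumes dom: "dominating_vertex (proper_complement_enhanced_power_graph G) v"
    and z: "z \<in> carrier G" "v \<in> generate G {z}"
  shows "z = v"
proof (rule ccontr)
  assume "z \<noteq> v"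
  moreover have "\<exists>w \<in> carrier G. \<not> cocyclic G z w"
    using dom cocyclic_generator_imp_cocyclic[OF z]
    by (auto simp: dominating_vertex_iff_cocyclic)
  ultimately have "\<not> cocyclic G v z"
    using dom z(1) by (auto simp: dominating_vertex_iff_cocyclic)
  then show False
    using z by (auto simp: cocyclic_def intro: generate.incl)
qed

lemma generate_involution:
  assumes x: "x \<in> carrier G" and inv: "inv x = x"
  shows "generate G {x} = {\<one>, x}"
proof
  have "x \<otimes> x = \<one>"
    using r_inv[OF x] inv by simp
  then have "subgroup {\<one>, x} G"
    using x inv by (intro subgroupI) auto
  then show "generate G {x} \<subseteq> {\<one>, x}"
    by (intro generate_subgroup_incl) auto
qed (auto intro: generate.incl generate.one)

lemma dominating_vertex_generates_maximal_cyclic_order_2: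
  assumes dom: "dominating_vertex (proper_complement_enhanced_power_graph G) v"
  shows "maximal_cyclic_subgroup (generate G {v}) G" and "card (generate G {v}) = 2"
proof -
  have v: "v \<in> carrier G" and "v \<noteq> \<one>"
    using dom cocyclic_one[of _ G] by (auto simp: dominating_vertex_iff_cocyclic)
  show "maximal_cyclic_subgroup (generate G {v}) G"
    using maximal_cyclic_generate_iff[OF v] dominating_vertex_only_generator[OF dom] by blast
  \<comment> \<open>The inverse of \<open>v\<close> is a second generator of \<open>\<langle>v\<rangle>\<close>, hence must coincide with \<open>v\<close>.\<close>
  have "v \<in> generate G {inv v}"
    using generate.inv[of "inv v" "{inv v}" G] v by simp
  then have "inv v = v"
    using dominating_vertex_only_generator[OF dom] v by simp
  then show "card (generate G {v}) = 2"
    using generate_involution[OF v] \<open>v \<noteq> \<one>\<close> by simp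
qed

text \<open>
  By maximality, a cyclic subgroup containing \<open>h\<close> is \<open>\<langle>h\<rangle> = {\<one>, h}\<close>, so \<open>h\<close> is cocyclic with nothing
  but \<open>\<one>\<close>, which is isolated, and itself. An element outside \<open>\<langle>h\<rangle>\<close> keeps \<open>h\<close> from being isolated.
\<close>

lemma generator_of_maximal_cyclic_order_2_dominating:
  assumes h: "h \<in> carrier G" and max: "maximal_cyclic_subgroup (generate G {h}) G"
    and card: "card (generate G {h}) = 2" and proper: "generate G {h} \<noteq> carrier G"
  shows "dominating_vertex (proper_complement_enhanced_power_graph G) h"
proof -
  \<comment> \<open>The trivial element counts as an involution in \<open>generate_involution\<close>, giving \<open>\<langle>\<one>\<rangle> = {\<one>}\<close>.\<close>
  have "h \<noteq> \<one>"
    using card generate_involution[of \<one>] by auto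
  moreover have "\<one> \<in> generate G {h}" "h \<in> generate G {h}"
    by (auto intro: generate.incl generate.one)
  ultimately have eq: "generate G {h} = {\<one>, h}"
    using card by (auto simp: card_2_iff)
  have *: "u \<in> {\<one>, h}" if "cocyclic G h u" for u
    using that max eq unfolding maximal_cyclic_generate_iff[OF h] cocyclic_def by metis
  obtain w where "w \<in> carrier G" "w \<notin> {\<one>, h}"
    using proper eq generate_incl[of "{h}"] h by auto
  then have "\<exists>w \<in> carrier G. \<not> cocyclic G h w"
    using * by blast
  then show ?thesis
    using * h cocyclic_one[of _ G] by (auto simp: dominating_vertex_iff_cocyclic)
qed

end

theorem theorem3p4:
  fixes G :: "('a, 'b) monoid_scheme"
  assumes "group G" and "finite (carrier G)" and "\<not> cyclic_group G"
  shows "dominatable (proper_complement_enhanced_power_graph G) \<longleftrightarrow>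
    (\<exists>H. maximal_cyclic_subgroup H G \<and> order (G\<lparr>carrier := H\<rparr>) = 2)"
proof -
  interpret group G by fact
  show ?thesis
  proof
    assume "dominatable (proper_complement_enhanced_power_graph G)"
    then show "\<exists>H. maximal_cyclic_subgroup H G \<and> order (G\<lparr>carrier := H\<rparr>) = 2"
      using dominating_vertex_generates_maximal_cyclic_order_2
      by (auto simp: dominatable_def order_def)
  next
    assume "\<exists>H. maximal_cyclic_subgroup H G \<and> order (G\<lparr>carrier := H\<rparr>) = 2"
    then obtain H where H: "maximal_cyclic_subgroup H G" "card H = 2"
      by (auto simp: order_def)
    then obtain h where h: "h \<in> carrier G" "H = generate G {h}"
      by (auto simp: maximal_cyclic_subgroup_def cyclic_subgroup_iff_generate)
    have "H \<noteq> carrier G"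
      using H(1) assms(3) by (auto simp: maximal_cyclic_subgroup_def cyclic_subgroup_def)
    then show "dominatable (proper_complement_enhanced_power_graph G)"
      using generator_of_maximal_cyclic_order_2_dominating[of h] H h
      by (auto simp: dominatable_def)
  qed
qed

end
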